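(* Let $\Gamma=(G,\sigma)$ be a signed graph, let $u,v$ be two distinct vertices of $\Gamma$, let $vv_1,\dots,vv_s$ ($s\ge 1$) be cut edges of $\Gamma$ such that $u\notin\{v_1,\dots,v_s\}$ and no $uv_i$ is an edge of $\Gamma$, and let $\mathbf x$ be an eigenvector of $A(\Gamma)$ corresponding to the index $\lambda(\Gamma)$. Let $$\Gamma'=\Gamma-vv_1-\cdots-vv_s+uv_1+\cdots+uv_s,$$ where each new edge $uv_i$ has the sign $\sigma(vv_i)$. If $x_u\ge x_v\ge 0$ or $x_u\le x_v\le 0$, then $\lambda(\Gamma')\ge\lambda(\Gamma)$.
   Context: A signed graph $\Gamma=(G,\sigma)$ is a finite simple graph $G$ with a map $\sigma:E(G)\to\{+1,-1\}$. Its adjacency matrix $A(\Gamma)$ has $(u,v)$ entry $\sigma(uv)$ if $uv\in E(G)$ and $0$ otherwise; the index $\lambda(\Gamma)$ is the largest eigenvalue of $A(\Gamma)$. For a vector $\mathbf x$ indexed by vertices, $x_u$ is its entry at $u$. A cut edge is an edge whose deletion increases the number of connected components. *)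

theory Defs
  imports "HOL-Analysis.Analysis"
begin

text \<open>
  The vertex set of a signed graph is the whole finite type \<open>'v\<close>; an edge is a two-element
  set of vertices. Only the values of \<open>sign\<close> on edges are meaningful.
\<close>

record 'v sgraph =
  edges :: "'v set set"
  sign :: "'v set \<Rightarrow> int"

definition signed_graph :: "('v::finite) sgraph \<Rightarrow> bool" where
  "signed_graph \<Gamma> \<longleftrightarrow>
     (\<forall>e\<in>edges \<Gamma>. card e = 2) \<and> (\<forall>e\<in>edges \<Gamma>. sign \<Gamma> e \<in> {1, -1})"

definition adjacency_matrix :: "('v::finite) sgraph \<Rightarrow> real^'v^'v" where
  "adjacency_matrix \<Gamma> =
     (\<chi> a b. if {a, b} \<in> edges \<Gamma> then real_of_int (sign \<Gamma> {a, b}) else 0)"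

definition eigenvector :: "real^'n^'n \<Rightarrow> real^('n::finite) \<Rightarrow> real \<Rightarrow> bool" where
  "eigenvector A x k \<longleftrightarrow> x \<noteq> 0 \<and> A *v x = k *\<^sub>R x"

definition eigenvalue :: "real^'n^('n::finite) \<Rightarrow> real \<Rightarrow> bool" where
  "eigenvalue A k \<longleftrightarrow> (\<exists>x. eigenvector A x k)"

text \<open>
  The adjacency matrix is symmetric, so all its eigenvalues are real and its set of
  eigenvalues is finite and nonempty.
\<close>

definition graph_index :: "('v::finite) sgraph \<Rightarrow> real" where
  "graph_index \<Gamma> = Max {k. eigenvalue (adjacency_matrix \<Gamma>) k}"

definition delete_edges :: "'v sgraph \<Rightarrow> 'v set set \<Rightarrow> 'v sgraph" where
  "delete_edges \<Gamma> F = \<Gamma>\<lparr>edges := edges \<Gamma> - F\<rparr>"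

definition add_edges :: "'v sgraph \<Rightarrow> 'v set set \<Rightarrow> ('v set \<Rightarrow> int) \<Rightarrow> 'v sgraph" where
  "add_edges \<Gamma> F \<tau> =
     \<lparr>edges = edges \<Gamma> \<union> F, sign = (\<lambda>e. if e \<in> F then \<tau> e else sign \<Gamma> e)\<rparr>"

definition components :: "('v::finite) sgraph \<Rightarrow> 'v set set" where
  "components \<Gamma> = UNIV // {(a, b). {a, b} \<in> edges \<Gamma>}\<^sup>*"

definition cut_edge :: "('v::finite) sgraph \<Rightarrow> 'v set \<Rightarrow> bool" where
  "cut_edge \<Gamma> e \<longleftrightarrow>
     e \<in> edges \<Gamma> \<and> card (components (delete_edges \<Gamma> {e})) > card (components \<Gamma>)"

end

theory Submission
  imports Defs
begin

text \<open>
  Moving the edges changes the quadratic form of \<open>x\<close> by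
  \<open>2 (x\<^sub>u - x\<^sub>v) \<Sum>\<^sub>p \<sigma>(vp) x\<^sub>p\<close>, where \<open>p\<close> runs over the \<open>v\<^sub>i\<close>, so by the Rayleigh principle it suffices that
  no term is negative. For a cut edge \<open>vp\<close>, negating \<open>x\<close> on the far side of the edge changes the
  quadratic form by \<open>-4 \<sigma>(vp) x\<^sub>v x\<^sub>p\<close>, and maximality of \<open>x\<close> gives \<open>\<sigma>(vp) x\<^sub>v x\<^sub>p \<ge> 0\<close>. If
  \<open>x\<^sub>v = 0\<close>, the negated vector is again an eigenvector for the index, so the
  restriction of \<open>x\<close> to the far side also satisfies the eigenvalue equation, which at \<open>v\<close> reads
  \<open>\<sigma>(vp) x\<^sub>p = 0\<close>.
\<close>

section \<open>The Rayleigh principle for symmetric matrices\<close>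

lemma inner_symmetric_matrix:
  fixes A :: "real^'n^'n::finite"
  assumes "transpose A = A"
  shows "x \<bullet> (A *v y) = (A *v x) \<bullet> y"
  by (metis assms dot_lmul_matrix transpose_matrix_vector)

lemma quadratic_form_eq_sum:
  fixes A :: "real^'n^'n::finite"
  shows "x \<bullet> (A *v x) = (\<Sum>a\<in>UNIV. \<Sum>b\<in>UNIV. A $ a $ b * x $ a * x $ b)"
  by (simp add: inner_vec_def matrix_vector_mult_def sum_distrib_left ac_simps)

text \<open>First-variation argument: perturb \<open>x\<close> along the residual
  \<open>r = A *v x - m *\<^sub>R x\<close>. The gain is linear in the step \<open>t\<close> and the
  loss only quadratic, so a small step would break the bound unless \<open>r = 0\<close>.\<close>

lemma maximizer_imp_eigen:
  fixes A :: "real^'n^'n::finite"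
  assumes sym: "transpose A = A"
    and bound: "\<And>y. y \<bullet> (A *v y) \<le> m * (y \<bullet> y)"
    and attained: "x \<bullet> (A *v x) = m * (x \<bullet> x)"
  shows "A *v x = m *\<^sub>R x"
proof -
  define r where "r = A *v x - m *\<^sub>R x"
  define c where "c = m * (r \<bullet> r) - r \<bullet> (A *v r)"
  have "c \<ge> 0"
    using bound[of r] by (simp add: c_def)
  \<comment> \<open>In the bound at \<open>x + t *\<^sub>R r\<close>, the constant terms cancel by
    \<open>attained\<close>, and \<open>A *v x = m *\<^sub>R x + r\<close> leaves
    \<open>2 * t * (r \<bullet> r)\<close> at first order.\<close>
  have quad: "2 * t * (r \<bullet> r) \<le> t\<^sup>2 * c" for t :: real
  proof -
    have rAx: "r \<bullet> (A *v x) = r \<bullet> r + m * (r \<bullet> x)"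
      by (metis r_def diff_add_cancel inner_add_right inner_scaleR_right)
    have "(x + t *\<^sub>R r) \<bullet> (A *v (x + t *\<^sub>R r)) \<le> m * ((x + t *\<^sub>R r) \<bullet> (x + t *\<^sub>R r))"
      by (rule bound)
    moreover have "x \<bullet> (A *v r) = r \<bullet> r + m * (r \<bullet> x)"
      using inner_symmetric_matrix[OF sym, of x r] rAx by (simp add: inner_commute)
    ultimately show ?thesis
      using attained
      by (simp add: c_def rAx matrix_vector_right_distrib matrix_vector_mult_scaleR inner_add_left
          inner_add_right inner_commute[of x r] algebra_simps power2_eq_square)
  qed
  have "r \<bullet> r \<le> 0"
  proof (rule ccontr)
    assume "\<not> r \<bullet> r \<le> 0"
    then have pos: "r \<bullet> r > 0" by linarith
    \<comment> \<open>This makes \<open>t * (c + 1)\<close> equal to \<open>r \<bullet> r\<close>;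
      the \<open>+ 1\<close> keeps the denominator positive when \<open>c = 0\<close>.\<close>
    define t where "t = (r \<bullet> r) / (c + 1)"
    have "t > 0" using pos \<open>c \<ge> 0\<close> by (simp add: t_def)
    have "2 * (r \<bullet> r) \<le> t * c"
      using quad[of t] \<open>t > 0\<close> by (simp add: power2_eq_square)
    also have "\<dots> \<le> t * (c + 1)"
      using \<open>t > 0\<close> by simp
    also have "\<dots> = r \<bullet> r"
      using \<open>c \<ge> 0\<close> by (simp add: t_def)
    finally show False using pos by simp
  qed
  then have "r = 0"
    by (metis inner_eq_zero_iff inner_ge_zero order_antisym)
  then show ?thesis by (simp add: r_def)
qed

text \<open>The quadratic form attains its maximum on the compact unit sphere, homogeneity extends
  the bound to all vectors, and a maximizer is an eigenvector.\<close>

lemma exists_max_eigenvalue: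
  fixes A :: "real^'n^'n::finite"
  assumes sym: "transpose A = A"
  shows "\<exists>m. eigenvalue A m \<and> (\<forall>y. y \<bullet> (A *v y) \<le> m * (y \<bullet> y))"
proof -
  let ?S = "sphere (0 :: real^'n) 1"
  have "?S \<noteq> {}"
    using sphere_eq_empty[of "0 :: real^'n" 1] by simp
  moreover have "continuous_on ?S (\<lambda>y. y \<bullet> (A *v y))"
    by (intro continuous_intros linear_continuous_on matrix_vector_mul_bounded_linear)
  ultimately obtain z where z: "z \<in> ?S" "\<And>y. y \<in> ?S \<Longrightarrow> y \<bullet> (A *v y) \<le> z \<bullet> (A *v z)"
    using continuous_attains_sup[OF compact_sphere, of 0 1 "\<lambda>y. y \<bullet> (A *v y)"] by blast
  define m where "m = z \<bullet> (A *v z)"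
  have bound: "y \<bullet> (A *v y) \<le> m * (y \<bullet> y)" for y
  proof (cases "y = 0")
    case False
    let ?y = "(1 / norm y) *\<^sub>R y"
    have "?y \<bullet> (A *v ?y) \<le> m"
      using z(2)[of ?y] False by (simp add: m_def)
    then have "(y \<bullet> (A *v y)) / (norm y)\<^sup>2 \<le> m"
      by (simp add: matrix_vector_mult_scaleR power2_eq_square)
    then show ?thesis
      using False by (simp add: divide_le_eq power2_norm_eq_inner)
  qed simp
  have zz: "z \<bullet> z = 1"
    using z(1) by (simp add: dot_square_norm)
  have "A *v z = m *\<^sub>R z"
    by (rule maximizer_imp_eigen[OF sym bound]) (simp add: m_def zz)
  moreover have "z \<noteq> 0" using zz by auto
  ultimately show ?thesis
    using bound unfolding eigenvalue_def eigenvector_def by blast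
qed

text \<open>Eigenvectors for distinct eigenvalues are orthogonal, hence independent, and independent
  sets here are finite. This makes the \<open>Max\<close> in \<open>graph_index\<close>
  meaningful.\<close>

lemma finite_eigenvalues:
  fixes A :: "real^'n^'n::finite"
  assumes sym: "transpose A = A"
  shows "finite {k. eigenvalue A k}"
proof -
  define f where "f k = (SOME x. eigenvector A x k)" for k
  have f: "eigenvector A (f k) k" if "eigenvalue A k" for k
    using that unfolding eigenvalue_def f_def by (rule someI_ex)
  have orth: "f k \<bullet> f l = 0" if "eigenvalue A k" "eigenvalue A l" "k \<noteq> l" for k l
  proof -
    have "l * (f k \<bullet> f l) = k * (f k \<bullet> f l)"
      using inner_symmetric_matrix[OF sym, of "f k" "f l"] f[OF that(1)] f[OF that(2)]
      by (simp add: eigenvector_def)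
    with \<open>k \<noteq> l\<close> show ?thesis by simp
  qed
  let ?K = "{k. eigenvalue A k}"
  have nz: "f k \<noteq> 0" if "k \<in> ?K" for k
    using f that by (simp add: eigenvector_def)
  have "inj_on f ?K"
    using orth nz by (metis (mono_tags, lifting) inj_onI inner_eq_zero_iff mem_Collect_eq)
  moreover have "pairwise orthogonal (f ` ?K)"
    using orth by (auto simp: pairwise_def orthogonal_def)
  then have "independent (f ` ?K)"
    using nz by (intro pairwise_orthogonal_independent) auto
  then have "finite (f ` ?K)"
    by (rule independent_imp_finite)
  ultimately show ?thesis
    by (simp add: finite_image_iff)
qed

lemma rayleigh_Max_eigenvalue:
  fixes A :: "real^'n^'n::finite"
  assumes sym: "transpose A = A"
  shows "y \<bullet> (A *v y) \<le> Max {k. eigenvalue A k} * (y \<bullet> y)"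
proof -
  obtain m where m: "eigenvalue A m" "\<And>y. y \<bullet> (A *v y) \<le> m * (y \<bullet> y)"
    using exists_max_eigenvalue[OF sym] by blast
  have "m \<le> Max {k. eigenvalue A k}"
    using m(1) finite_eigenvalues[OF sym] by simp
  then show ?thesis
    using m(2)[of y] mult_right_mono[of m _ "y \<bullet> y"] by fastforce
qed

lemma transpose_adjacency_matrix: "transpose (adjacency_matrix \<Gamma>) = adjacency_matrix \<Gamma>"
  by (simp add: vec_eq_iff transpose_def adjacency_matrix_def insert_commute)

lemma rayleigh_graph_index:
  "y \<bullet> (adjacency_matrix \<Gamma> *v y) \<le> graph_index \<Gamma> * (y \<bullet> y)"
  unfolding graph_index_def
  by (rule rayleigh_Max_eigenvalue) (rule transpose_adjacency_matrix)

section \<open>Cut edges\<close>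

text \<open>Otherwise a path from \<open>v\<close> to \<open>p\<close> avoiding the edge could
  replace every use of it, and deletion would leave the components unchanged.\<close>

lemma cut_edge_not_connected:
  assumes "cut_edge \<Gamma> {v, p}"
  shows "(v, p) \<notin> {(a, b). {a, b} \<in> edges \<Gamma> - {{v, p}}}\<^sup>*"
proof
  let ?R = "{(a, b). {a, b} \<in> edges \<Gamma>}"
  let ?R' = "{(a, b). {a, b} \<in> edges \<Gamma> - {{v, p}}}"
  assume vp: "(v, p) \<in> ?R'\<^sup>*"
  have "sym ?R'"
    by (auto simp: sym_def insert_commute)
  then have pv: "(p, v) \<in> ?R'\<^sup>*"
    using vp by (meson sym_rtrancl symD)
  have "?R \<subseteq> ?R'\<^sup>*"
  proof
    fix e assume e: "e \<in> ?R"
    obtain a b where [simp]: "e = (a, b)" by (cases e)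
    show "e \<in> ?R'\<^sup>*"
    proof (cases "{a, b} = {v, p}")
      case True
      then show ?thesis using vp pv by (auto simp: doubleton_eq_iff)
    next
      case False
      then show ?thesis using e by (auto intro!: r_into_rtrancl)
    qed
  qed
  moreover have "?R' \<subseteq> ?R" by auto
  ultimately have "?R'\<^sup>* = ?R\<^sup>*"
    by (metis rtrancl_subset)
  then have "components (delete_edges \<Gamma> {{v, p}}) = components \<Gamma>"
    by (simp add: components_def delete_edges_def)
  then show False
    using assms by (simp add: cut_edge_def)
qed

text \<open>Take as \<open>S\<close> the vertices reachable from \<open>v\<close> without the cut
  edge: any other edge leaving \<open>S\<close> would extend reachability.\<close>

lemma cut_edge_side:
  assumes "cut_edge \<Gamma> {v, p}"
  obtains S where "v \<in> S" "p \<notin> S"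
    "\<And>a b. {a, b} \<in> edges \<Gamma> \<Longrightarrow> a \<in> S \<Longrightarrow> b \<notin> S \<Longrightarrow> a = v \<and> b = p"
proof
  let ?R' = "{(a, b). {a, b} \<in> edges \<Gamma> - {{v, p}}}"
  let ?S = "{a. (v, a) \<in> ?R'\<^sup>*}"
  show "v \<in> ?S" by simp
  show pS: "p \<notin> ?S" using cut_edge_not_connected[OF assms] by simp
  fix a b assume ab: "{a, b} \<in> edges \<Gamma>" "a \<in> ?S" "b \<notin> ?S"
  have "(a, b) \<notin> ?R'"
    using ab(2,3) rtrancl_into_rtrancl[of v a ?R' b] by blast
  with ab(1) have "{a, b} = {v, p}" by auto
  then show "a = v \<and> b = p"
    using ab(2) pS by (auto simp: doubleton_eq_iff)
qed

text \<open>The test vector \<open>y\<close> flips the sign of \<open>x\<close> off the side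
  \<open>S\<close> of \<open>v\<close>. The Rayleigh bound at \<open>y\<close> gives the first
  claim, its equality case the second.\<close>

lemma cut_edge_eigenvector:
  fixes \<Gamma> :: "('v::finite) sgraph"
  defines "A \<equiv> adjacency_matrix \<Gamma>"
  assumes cut: "cut_edge \<Gamma> {v, p}"
    and eig: "A *v x = graph_index \<Gamma> *\<^sub>R x"
  shows "A $ v $ p * x $ p * x $ v \<ge> 0"
    and "x $ v = 0 \<Longrightarrow> A $ v $ p * x $ p = 0"
proof -
  obtain S where S: "v \<in> S" "p \<notin> S"
    and side: "\<And>a b. {a, b} \<in> edges \<Gamma> \<Longrightarrow> a \<in> S \<Longrightarrow> b \<notin> S \<Longrightarrow> a = v \<and> b = p"
    using cut_edge_side[OF cut] by metis
  have A0: "A $ a $ b = 0" if "a \<in> S" "b \<notin> S" "\<not> (a = v \<and> b = p)" for a b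
    using side that by (auto simp: A_def adjacency_matrix_def)
  have sym: "transpose A = A"
    by (simp add: A_def transpose_adjacency_matrix)
  have Asym: "A $ a $ b = A $ b $ a" for a b
    by (simp add: A_def adjacency_matrix_def insert_commute)
  define y :: "real^'v" where "y = (\<chi> a. if a \<in> S then x $ a else - x $ a)"
  have yy: "y \<bullet> y = x \<bullet> x"
    unfolding inner_vec_def by (rule sum.cong) (auto simp: y_def)
  \<comment> \<open>Within either side the two sign changes cancel, and across the sides only the
    entries at \<open>(v, p)\<close> and \<open>(p, v)\<close> can be nonzero. Each loses twice its
    value, whence the factor 4 in \<open>quad\<close>.\<close>
  have entry: "A $ a $ b * y $ a * y $ b = A $ a $ b * x $ a * x $ b
      - (if a = v \<and> b = p then 2 * (A $ v $ p * x $ p * x $ v) else 0)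
      - (if a = p \<and> b = v then 2 * (A $ v $ p * x $ p * x $ v) else 0)" for a b
  proof -
    have "p \<noteq> v" using S by auto
    consider "a \<in> S" "b \<in> S" | "a \<notin> S" "b \<notin> S" | "a = v" "b = p" | "a = p" "b = v"
      | "A $ a $ b = 0" "\<not> (a = v \<and> b = p)" "\<not> (a = p \<and> b = v)"
      using A0[of a b] A0[of b a] Asym[of a b] by argo
    then show ?thesis
    proof cases
      case 1
      then have "a \<noteq> p" "b \<noteq> p" using S by auto
      then show ?thesis using 1 by (simp add: y_def)
    next
      case 2
      then have "a \<noteq> v" "b \<noteq> v" using S by auto
      then show ?thesis using 2 by (simp add: y_def)
    next
      case 3
      then show ?thesis using S \<open>p \<noteq> v\<close> by (simp add: y_def)
    next
      case 4
      then show ?thesis using S \<open>p \<noteq> v\<close> Asym[of p v] by (simp add: y_def)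
    next
      case 5
      then show ?thesis by (simp only: mult_zero_left if_False diff_0_right)
    qed
  qed
  have delta: "(\<Sum>a\<in>UNIV. \<Sum>b\<in>UNIV. if a = q \<and> b = r then k else 0) = (k :: real)"
    for q r :: 'v and k
  proof -
    have "(\<Sum>a\<in>UNIV. \<Sum>b\<in>UNIV. if a = q \<and> b = r then k else 0)
        = (\<Sum>a\<in>UNIV. if a = q then (\<Sum>b\<in>UNIV. if b = r then k else 0) else 0)"
      by (rule sum.cong) auto
    then show ?thesis by simp
  qed
  have quad: "y \<bullet> (A *v y) = x \<bullet> (A *v x) - 4 * (A $ v $ p * x $ p * x $ v)"
    unfolding quadratic_form_eq_sum entry sum_subtractf delta by simp
  have xx: "x \<bullet> (A *v x) = graph_index \<Gamma> * (x \<bullet> x)"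
    by (simp add: eig)
  show "A $ v $ p * x $ p * x $ v \<ge> 0"
    using rayleigh_graph_index[of y \<Gamma>, folded A_def] unfolding quad xx yy by linarith
  assume xv: "x $ v = 0"
  have "A *v y = graph_index \<Gamma> *\<^sub>R y"
  proof (rule maximizer_imp_eigen[OF sym])
    show "z \<bullet> (A *v z) \<le> graph_index \<Gamma> * (z \<bullet> z)" for z
      unfolding A_def by (rule rayleigh_graph_index)
    show "y \<bullet> (A *v y) = graph_index \<Gamma> * (y \<bullet> y)"
      unfolding quad xx yy by (simp add: xv)
  qed
  \<comment> \<open>\<open>x - y\<close> vanishes on \<open>S\<close> and is twice \<open>x\<close>
    elsewhere, so row \<open>v\<close> of the eigenvalue equation retains only the term of
    \<open>p\<close>.\<close>
  then have "A *v (x - y) = graph_index \<Gamma> *\<^sub>R (x - y)"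
    by (simp add: eig matrix_vector_mult_diff_distrib scaleR_diff_right)
  then have "(A *v (x - y)) $ v = 0"
    using xv S by (simp add: y_def)
  moreover have "(A *v (x - y)) $ v = (\<Sum>b\<in>UNIV. if b = p then 2 * (A $ v $ p * x $ p) else 0)"
    unfolding matrix_vector_mult_def vec_lambda_beta
    by (rule sum.cong) (use S A0[of v] in \<open>auto simp: y_def\<close>)
  ultimately show "A $ v $ p * x $ p = 0" by simp
qed

section \<open>Moving edges\<close>

text \<open>A column \<open>b\<close> in \<open>W\<close> loses its entry in row \<open>v\<close>
  and gains it in row \<open>u\<close>. The second correction is the transpose of the first, a form
  that suits summation.\<close>

lemma adjacency_matrix_move_edges:
  fixes \<Gamma> :: "('v::finite) sgraph"
  assumes "u \<noteq> v" "u \<notin> W" "v \<notin> W"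
    and old: "\<And>p. p \<in> W \<Longrightarrow> {v, p} \<in> edges \<Gamma>"
    and new: "\<And>p. p \<in> W \<Longrightarrow> {u, p} \<notin> edges \<Gamma>"
    and sgn: "\<And>p. p \<in> W \<Longrightarrow> \<tau> {u, p} = sign \<Gamma> {v, p}"
    and \<Gamma>': "\<Gamma>' = add_edges (delete_edges \<Gamma> ((\<lambda>p. {v, p}) ` W)) ((\<lambda>p. {u, p}) ` W) \<tau>"
  defines "A \<equiv> adjacency_matrix \<Gamma>"
  shows "adjacency_matrix \<Gamma>' $ a $ b = A $ a $ b
      + (if b \<in> W then A $ v $ b * (of_bool (a = u) - of_bool (a = v)) else 0)
      + (if a \<in> W then A $ v $ a * (of_bool (b = u) - of_bool (b = v)) else 0)"
proof -
  have nmem: "{a, b} \<in> (\<lambda>p. {q, p}) ` W \<longleftrightarrow> (a = q \<and> b \<in> W \<or> b = q \<and> a \<in> W)" for a b q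
    by (auto simp: doubleton_eq_iff)
  have entry: "adjacency_matrix \<Gamma>' $ a $ b =
      (if {a, b} \<in> (\<lambda>p. {u, p}) ` W then real_of_int (\<tau> {a, b})
       else if {a, b} \<in> (\<lambda>p. {v, p}) ` W then 0 else A $ a $ b)" for a b
    by (simp add: \<Gamma>' A_def adjacency_matrix_def add_edges_def delete_edges_def)
  have Av: "A $ v $ p = real_of_int (sign \<Gamma> {v, p})" if "p \<in> W" for p
    using old[OF that] by (simp add: A_def adjacency_matrix_def)
  have Au: "A $ u $ p = 0" if "p \<in> W" for p
    using new[OF that] by (simp add: A_def adjacency_matrix_def)
  have Asym: "A $ q $ r = A $ r $ q" for q r
    by (simp add: A_def adjacency_matrix_def insert_commute)
  \<comment> \<open>As \<open>u\<close> and \<open>v\<close> lie outside \<open>W\<close>, exactly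
    one correction survives in each of the first four cases and none in the last.\<close>
  consider "a = u" "b \<in> W" | "a = v" "b \<in> W" | "b = u" "a \<in> W" | "b = v" "a \<in> W"
    | "\<not> (b \<in> W \<and> (a = u \<or> a = v))" "\<not> (a \<in> W \<and> (b = u \<or> b = v))"
    by blast
  then show ?thesis
  proof cases
    case 1
    then show ?thesis
      using assms(1-3) by (simp add: entry nmem sgn Av Au)
  next
    case 2
    then show ?thesis
      using assms(1-3) by (simp add: entry nmem)
  next
    case 3
    then show ?thesis
      using assms(1-3) sgn[of a] Asym[of a u] by (simp add: entry nmem Av Au insert_commute[of a u])
  next
    case 4
    then show ?thesis
      using assms(1-3) Asym[of a v] by (simp add: entry nmem)
  next
    case 5
    then have "{a, b} \<notin> (\<lambda>p. {u, p}) ` W" "{a, b} \<notin> (\<lambda>p. {v, p}) ` W"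
      by (simp_all only: nmem) blast+
    then have "adjacency_matrix \<Gamma>' $ a $ b = A $ a $ b"
      by (simp only: entry if_False)
    with 5 show ?thesis
      by (cases "a \<in> W"; cases "b \<in> W") simp_all
  qed
qed

text \<open>The two corrections are transposes of each other, so they contribute equally once the
  order of summation is swapped; hence the factor 2.\<close>

lemma quadratic_form_move_edges:
  fixes \<Gamma> :: "('v::finite) sgraph"
  assumes "u \<noteq> v" "u \<notin> W" "v \<notin> W"
    and "\<And>p. p \<in> W \<Longrightarrow> {v, p} \<in> edges \<Gamma>"
    and "\<And>p. p \<in> W \<Longrightarrow> {u, p} \<notin> edges \<Gamma>"
    and "\<And>p. p \<in> W \<Longrightarrow> \<tau> {u, p} = sign \<Gamma> {v, p}"
    and "\<Gamma>' = add_edges (delete_edges \<Gamma> ((\<lambda>p. {v, p}) ` W)) ((\<lambda>p. {u, p}) ` W) \<tau>"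
  defines "A \<equiv> adjacency_matrix \<Gamma>"
  shows "x \<bullet> (adjacency_matrix \<Gamma>' *v x)
      = x \<bullet> (A *v x) + 2 * (\<Sum>p\<in>W. A $ v $ p * x $ p * (x $ u - x $ v))"
proof -
  let ?g = "\<lambda>a b. if b \<in> W
    then A $ v $ b * (of_bool (a = u) - of_bool (a = v)) * x $ a * x $ b else 0"
  have term_eq: "adjacency_matrix \<Gamma>' $ a $ b * x $ a * x $ b
      = A $ a $ b * x $ a * x $ b + ?g a b + ?g b a" for a b
  proof -
    note move = adjacency_matrix_move_edges[OF assms(1-7), where a = a and b = b, folded A_def]
    show ?thesis
      by (subst move, cases "a \<in> W"; cases "b \<in> W") (simp_all add: algebra_simps)
  qed
  have inner: "(\<Sum>a\<in>UNIV. ?g a b) = (if b \<in> W then A $ v $ b * x $ b * (x $ u - x $ v) else 0)" for b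
  proof -
    have "(\<Sum>a\<in>UNIV. ?g a b) = (\<Sum>a\<in>UNIV. (if a = u then (if b \<in> W then A $ v $ b * x $ b * x $ u else 0) else 0)
        - (if a = v then (if b \<in> W then A $ v $ b * x $ b * x $ v else 0) else 0))"
      by (rule sum.cong) auto
    then show ?thesis by (simp add: sum_subtractf right_diff_distrib)
  qed
  have total: "(\<Sum>b\<in>UNIV. \<Sum>a\<in>UNIV. ?g a b) = (\<Sum>p\<in>W. A $ v $ p * x $ p * (x $ u - x $ v))"
    unfolding inner by (simp add: sum.If_cases)
  have "(\<Sum>a\<in>UNIV. \<Sum>b\<in>UNIV. ?g a b) = (\<Sum>b\<in>UNIV. \<Sum>a\<in>UNIV. ?g a b)"
    by (rule sum.swap)
  then show ?thesis
    unfolding quadratic_form_eq_sum term_eq sum.distrib using total by simp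
qed

theorem lemma2p3:
  fixes \<Gamma> \<Gamma>' :: "('v::finite) sgraph"
    and u v :: 'v
    and s :: nat
    and w :: "nat \<Rightarrow> 'v"
    and \<tau> :: "'v set \<Rightarrow> int"
    and x :: "real^'v"
  assumes "signed_graph \<Gamma>"
    and "u \<noteq> v"
    and "s \<ge> 1"
    and "\<And>i. i \<in> {1..s} \<Longrightarrow> cut_edge \<Gamma> {v, w i}"
    and "u \<notin> w ` {1..s}"
    and "\<And>i. i \<in> {1..s} \<Longrightarrow> {u, w i} \<notin> edges \<Gamma>"
    and "eigenvector (adjacency_matrix \<Gamma>) x (graph_index \<Gamma>)"
    and "\<And>i. i \<in> {1..s} \<Longrightarrow> \<tau> {u, w i} = sign \<Gamma> {v, w i}"
    and "\<Gamma>' = add_edges (delete_edges \<Gamma> ((\<lambda>i. {v, w i}) ` {1..s}))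
                ((\<lambda>i. {u, w i}) ` {1..s}) \<tau>"
    and "x $ u \<ge> x $ v \<and> x $ v \<ge> 0 \<or> x $ u \<le> x $ v \<and> x $ v \<le> 0"
  shows "graph_index \<Gamma>' \<ge> graph_index \<Gamma>"
proof -
  \<comment> \<open>Repeated values of \<open>w\<close> name the same edge; summing over the image
    counts each moved edge once.\<close>
  define W where "W = w ` {1..s}"
  define A where "A = adjacency_matrix \<Gamma>"
  have cut: "cut_edge \<Gamma> {v, p}" if "p \<in> W" for p
    using assms(4) that by (auto simp: W_def)
  then have edge: "{v, p} \<in> edges \<Gamma>" if "p \<in> W" for p
    using that by (simp add: cut_edge_def)
  have "card {v, p} = 2" if "p \<in> W" for p
    using assms(1) edge[OF that] by (simp add: signed_graph_def)
  \<comment> \<open>A value \<open>w i = v\<close> would make the edge \<open>{v, w i}\<close> a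
    singleton.\<close>
  then have "v \<notin> W" by fastforce
  have eig: "A *v x = graph_index \<Gamma> *\<^sub>R x" and "x \<noteq> 0"
    using assms(7) by (simp_all add: A_def eigenvector_def)
  have "A $ v $ p * x $ p * (x $ u - x $ v) \<ge> 0" if "p \<in> W" for p
  proof -
    have nonneg: "A $ v $ p * x $ p * x $ v \<ge> 0"
      and zero: "x $ v = 0 \<Longrightarrow> A $ v $ p * x $ p = 0"
      using cut_edge_eigenvector[OF cut[OF that]] eig by (simp_all add: A_def)
    \<comment> \<open>For \<open>x $ v = 0\<close> the inequality \<open>nonneg\<close> says nothing
      about \<open>x $ p\<close>, so \<open>zero\<close> is used; otherwise \<open>nonneg\<close>
      gives \<open>A $ v $ p * x $ p\<close> the weak sign of \<open>x $ v\<close>, which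
      \<open>x $ u - x $ v\<close> shares.\<close>
    consider "x $ v = 0" | "x $ v > 0" "x $ u \<ge> x $ v" | "x $ v < 0" "x $ u \<le> x $ v"
      using assms(10) by linarith
    then show ?thesis
    proof cases
      case 1
      with zero show ?thesis by (simp only: mult_zero_left)
    next
      case 2
      with nonneg have "A $ v $ p * x $ p \<ge> 0"
        by (simp add: zero_le_mult_iff)
      with 2 show ?thesis by simp
    next
      case 3
      with nonneg have "A $ v $ p * x $ p \<le> 0"
        by (simp add: zero_le_mult_iff)
      with 3 show ?thesis by (simp add: mult_nonpos_nonpos)
    qed
  qed
  then have "(\<Sum>p\<in>W. A $ v $ p * x $ p * (x $ u - x $ v)) \<ge> 0"
    by (rule sum_nonneg)
  moreover have "x \<bullet> (adjacency_matrix \<Gamma>' *v x)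
      = x \<bullet> (A *v x) + 2 * (\<Sum>p\<in>W. A $ v $ p * x $ p * (x $ u - x $ v))"
    unfolding A_def
  proof (rule quadratic_form_move_edges)
    show "\<Gamma>' = add_edges (delete_edges \<Gamma> ((\<lambda>p. {v, p}) ` W)) ((\<lambda>p. {u, p}) ` W) \<tau>"
      using assms(9) by (simp add: W_def image_image)
  qed (use assms(2,5,6,8) \<open>v \<notin> W\<close> edge in \<open>auto simp: W_def\<close>)
  \<comment> \<open>Here \<open>x\<close> serves as a test vector for the index of \<Gamma>'; it
    need not be an eigenvector there.\<close>
  ultimately have "graph_index \<Gamma> * (x \<bullet> x) \<le> graph_index \<Gamma>' * (x \<bullet> x)"
    using rayleigh_graph_index[of x \<Gamma>'] by (simp add: eig)
  moreover have "x \<bullet> x > 0" using \<open>x \<noteq> 0\<close> by simp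
  ultimately show ?thesis by simp
qed

end
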